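(* For every integer $t\ge 4$, the tree $T(t,t,t+1,t)$ has $n=8t+6$ vertices (so $n\equiv 2 \pmod 4$) and satisfies \[ \pi(T(t,t,t+1,t)) > \frac{4n^2+8n+40}{(n+2)^2}\left(\frac32\right)^{(n-6)/2}. \]
   Context: All graphs are finite and simple. For a graph $G$, $d(v)$ denotes the degree of a vertex $v$, and $L(G)=D(G)-A(G)$ is the Laplacian matrix, where $A(G)$ is the adjacency matrix and $D(G)$ is the diagonal matrix of degrees. The permanent of an $n\times n$ matrix $M=(m_{ij})$ is $\operatorname{per}(M)=\sum_{\sigma\in S_n}\prod_{i=1}^n m_{i,\sigma(i)}$. If $G$ has no isolated vertices, its Laplacian ratio is $\pi(G)=\operatorname{per}(L(G))/\prod_{v\in V(G)}d(v)$. For $m\ge 2$ and nonnegative integers $a_1,\ldots,a_m$, the tree $T(a_1,\ldots,a_m)$ is obtained from the path $x_1-x_2-\cdots-x_m$ by attaching, for each $i$, exactly $a_i$ pendant paths of length two to the vertex $x_i$; that is, each attached path has the form $x_i-y-z$ with new vertices $y,z$, where $y$ is adjacent exactly to $x_i$ and $z$, and $z$ is a leaf. *)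

theory Defs
  imports Complex_Main "HOL-Combinatorics.Permutations"
begin

record 'a graph =
  vertices :: "'a set"
  edges :: "'a set set"

definition simple_graph :: "'a graph \<Rightarrow> bool" where
  "simple_graph G \<longleftrightarrow> finite (vertices G) \<and>
     (\<forall>e \<in> edges G. \<exists>u \<in> vertices G. \<exists>v \<in> vertices G. u \<noteq> v \<and> e = {u, v})"

definition degree :: "'a graph \<Rightarrow> 'a \<Rightarrow> nat" where
  "degree G v = card {u \<in> vertices G. {v, u} \<in> edges G}"

text \<open>Matrices are indexed by the vertices themselves: a matrix with index set \<open>V\<close> is a function
  of two arguments, of which only the entries with both indices in \<open>V\<close> matter.\<close>

definition adjacency_matrix :: "'a graph \<Rightarrow> 'a \<Rightarrow> 'a \<Rightarrow> real" where
  "adjacency_matrix G u v = (if {u, v} \<in> edges G then 1 else 0)"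

definition degree_matrix :: "'a graph \<Rightarrow> 'a \<Rightarrow> 'a \<Rightarrow> real" where
  "degree_matrix G u v = (if u = v then real (degree G u) else 0)"

definition laplacian :: "'a graph \<Rightarrow> 'a \<Rightarrow> 'a \<Rightarrow> real" where
  "laplacian G u v = degree_matrix G u v - adjacency_matrix G u v"

definition permanent :: "'a set \<Rightarrow> ('a \<Rightarrow> 'a \<Rightarrow> real) \<Rightarrow> real" where
  "permanent V M = (\<Sum>\<sigma> | \<sigma> permutes V. \<Prod>i\<in>V. M i (\<sigma> i))"

text \<open>Meaningful only for graphs without isolated vertices; otherwise the denominator is \<open>0\<close>.\<close>

definition laplacian_ratio :: "'a graph \<Rightarrow> real" where
  "laplacian_ratio G =
     permanent (vertices G) (laplacian G) / (\<Prod>v \<in> vertices G. real (degree G v))"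

text \<open>The vertices of \<open>T(a\<^sub>1, \<dots>, a\<^sub>m)\<close>, where the list \<open>a\<close> and the spine are indexed from \<open>0\<close>:
  \<open>X i\<close> is the spine vertex \<open>x\<^sub>i\<^sub>+\<^sub>1\<close>, and \<open>X i - Y i j - Z i j\<close> is the \<open>j\<close>-th pendant path
  attached to it.\<close>

datatype tvertex = X nat | Y nat nat | Z nat nat

definition T :: "nat list \<Rightarrow> tvertex graph" where
  "T a = \<lparr>
     vertices = {X i | i. i < length a}
       \<union> {Y i j | i j. i < length a \<and> j < a ! i}
       \<union> {Z i j | i j. i < length a \<and> j < a ! i},
     edges = {{X i, X (Suc i)} | i. Suc i < length a}
       \<union> {{X i, Y i j} | i j. i < length a \<and> j < a ! i}
       \<union> {{Y i j, Z i j} | i j. i < length a \<and> j < a ! i}\<rparr>"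

lemma finite_vertices_T: "finite (vertices (T a))"
proof -
  have "vertices (T a) = X ` {..<length a}
      \<union> (\<Union>i<length a. Y i ` {..<a ! i}) \<union> (\<Union>i<length a. Z i ` {..<a ! i})"
    unfolding T_def by auto
  then show ?thesis by simp
qed

lemma simple_graph_T: "simple_graph (T a)"
proof -
  have "\<exists>u \<in> vertices (T a). \<exists>v \<in> vertices (T a). u \<noteq> v \<and> e = {u, v}"
    if e: "e \<in> edges (T a)" for e
  proof -
    from e consider i where "Suc i < length a" "e = {X i, X (Suc i)}"
      | i j where "i < length a" "j < a ! i" "e = {X i, Y i j}"
      | i j where "i < length a" "j < a ! i" "e = {Y i j, Z i j}"
      by (auto simp: T_def)
    then show ?thesis
    proof cases
      case (1 i)
      then show ?thesis
        by (intro bexI[of _ "X i"] bexI[of _ "X (Suc i)"]) (simp_all add: T_def)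
    next
      case (2 i j)
      then show ?thesis
        by (intro bexI[of _ "X i"] bexI[of _ "Y i j"]) (simp_all add: T_def)
    next
      case (3 i j)
      then show ?thesis
        by (intro bexI[of _ "Y i j"] bexI[of _ "Z i j"]) (simp_all add: T_def)
    qed
  qed
  then show ?thesis
    using finite_vertices_T[of a] unfolding simple_graph_def by blast
qed

lemma degree_T_pos:
  assumes "2 \<le> length a" and v: "v \<in> vertices (T a)"
  shows "0 < degree (T a) v"
proof -
  have "\<exists>u \<in> vertices (T a). {v, u} \<in> edges (T a)"
  proof (cases v)
    case (X i)
    show ?thesis
    proof (cases "Suc i < length a")
      case True
      then show ?thesis using X by (intro bexI[of _ "X (Suc i)"]) (auto simp: T_def)
    next
      case False
      with X v assms obtain k where "i = Suc k" "Suc k < length a"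
        by (cases i) (auto simp: T_def)
      then show ?thesis using X
        by (intro bexI[of _ "X k"]) (auto simp: T_def insert_commute)
    qed
  next
    case (Y i j)
    then show ?thesis using v by (intro bexI[of _ "Z i j"]) (auto simp: T_def)
  next
    case (Z i j)
    then show ?thesis using v
      by (intro bexI[of _ "Y i j"]) (auto simp: T_def insert_commute)
  qed
  then show ?thesis
    using finite_vertices_T[of a] by (auto simp: degree_def card_gt_0_iff)
qed

end

theory Submission
  imports Defs
begin

text \<open>
  In a permutation that contributes to the permanent of a Laplacian, a leaf \<open>z\<close> with neighbour \<open>y\<close>
  is either fixed or swapped with \<open>y\<close>; in the swap the two entries \<open>-1\<close> multiply to \<open>1\<close>. After each row
  is divided by its degree, this gives the deletion rule \<open>local_ratio_leaf\<close>,
  \<open>w V = w (V - {z}) + w (V - {y, z}) / (d(y) d(z))\<close>. For trees this makes the Laplacian ratio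
  the sum over all matchings of the products of \<open>1 / (d(u) d(v))\<close> over the matched edges \<open>uv\<close>.

  Two leaf deletions remove a pendant path of length two. If its spine vertex has already been
  removed, the path contributes a factor \<open>3/2\<close>; otherwise there is an additional term in which the
  path blocks its spine vertex. Altogether \<open>a\<close> paths at a spine vertex of degree \<open>d\<close> give the factor
  \<open>(3/2)^a\<close> and change the weight of leaving that vertex unmatched along the spine from \<open>1\<close> to
  \<open>1 + a / (3d)\<close> (\<open>local_ratio_attached_paths\<close>). What is left is the matching sum of a path with
  weighted vertices, computed by a three-term recursion along the spine
  (\<open>local_ratio_tail_step\<close>); for four spine vertices it has five terms
  (\<open>laplacian_ratio_spine_4\<close>).

  For \<open>T(t, t, t + 1, t)\<close> there are \<open>4t + 1\<close> pendant paths and \<open>(n - 6) / 2 = 4t\<close>, so the power of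
  \<open>3/2\<close> cancels up to one factor and a comparison of two rational functions of \<open>t\<close> remains. Their
  limits are \<open>3/2 \<cdot> (4/3)^4 = 128/27\<close> and \<open>4\<close>; after clearing denominators, the difference has positive
  coefficients as a polynomial in \<open>t - 4\<close> (\<open>matching_sum_bound\<close>).
\<close>

section \<open>Expanding a permanent at a row and column with few nonzero entries\<close>

lemma permanent_fixed_index:
  assumes "finite V" "z \<in> V"
  shows "(\<Sum>\<sigma> | \<sigma> permutes V \<and> \<sigma> z = z. \<Prod>i\<in>V. M i (\<sigma> i)) = M z z * permanent (V - {z}) M"
proof -
  have "{\<sigma>. \<sigma> permutes V \<and> \<sigma> z = z} = {\<sigma>. \<sigma> permutes V - {z}}" (is "?A = ?B")
  proof (intro equalityI subsetI)
    fix \<sigma> assume "\<sigma> \<in> ?A"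
    then have "\<sigma> permutes V" "\<sigma> z = z" by auto
    then have "\<sigma> permutes V - {z}" by (elim permutes_superset) auto
    then show "\<sigma> \<in> ?B" by simp
  next
    fix \<sigma> assume "\<sigma> \<in> ?B"
    then have \<sigma>: "\<sigma> permutes V - {z}" by simp
    then have "\<sigma> permutes V" by (rule permutes_subset) auto
    moreover have "\<sigma> z = z" using \<sigma> by (simp add: permutes_not_in)
    ultimately show "\<sigma> \<in> ?A" by simp
  qed
  moreover have "(\<Prod>i\<in>V. M i (\<sigma> i)) = M z z * (\<Prod>i\<in>V - {z}. M i (\<sigma> i))"
    if "\<sigma> permutes V - {z}" for \<sigma>
    using prod.remove[OF assms, of "\<lambda>i. M i (\<sigma> i)"] that by (simp add: permutes_not_in)
  ultimately show ?thesis
    by (simp add: permanent_def sum_distrib_left)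
qed

lemma permanent_isolated:
  assumes V: "finite V" "z \<in> V"
    and row: "\<And>v. v \<in> V \<Longrightarrow> v \<noteq> z \<Longrightarrow> M z v = 0"
  shows "permanent V M = M z z * permanent (V - {z}) M"
proof -
  have "(\<Prod>i\<in>V. M i (\<sigma> i)) = 0" if "\<sigma> permutes V" "\<sigma> z \<noteq> z" for \<sigma>
    using V row[of "\<sigma> z"] that permutes_in_image[OF that(1), of z]
    by (intro prod_zero) auto
  then have "permanent V M = (\<Sum>\<sigma> | \<sigma> permutes V \<and> \<sigma> z = z. \<Prod>i\<in>V. M i (\<sigma> i))"
    unfolding permanent_def using V finite_permutations
    by (intro sum.mono_neutral_right) auto
  then show ?thesis using permanent_fixed_index[OF V] by simp
qed

text \<open>If the only off-diagonal entries of row and column \<open>z\<close> are those at \<open>y\<close>, a permutation with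
  nonzero product that moves \<open>z\<close> must send \<open>z\<close> to \<open>y\<close> (row) and \<open>y\<close> to \<open>z\<close> (column), so it is the
  transposition of \<open>y\<close> and \<open>z\<close> composed with a permutation of the other indices.\<close>

lemma permanent_leaf:
  assumes V: "finite V" "z \<in> V" "y \<in> V" "y \<noteq> z"
    and row: "\<And>v. v \<in> V \<Longrightarrow> v \<noteq> z \<Longrightarrow> v \<noteq> y \<Longrightarrow> M z v = 0"
    and col: "\<And>v. v \<in> V \<Longrightarrow> v \<noteq> z \<Longrightarrow> v \<noteq> y \<Longrightarrow> M v z = 0"
  shows "permanent V M
    = M z z * permanent (V - {z}) M + M z y * M y z * permanent (V - {y, z}) M"
proof -
  let ?f = "\<lambda>\<sigma>. \<Prod>i\<in>V. M i (\<sigma> i)"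
  let ?s = "transpose y z"
  let ?A = "{\<sigma>. \<sigma> permutes V \<and> \<sigma> z = z}"
  let ?P = "{\<tau>. \<tau> permutes V - {y, z}}"
  let ?B = "(\<lambda>\<tau>. ?s \<circ> \<tau>) ` ?P"
  have fix_yz: "\<tau> y = y" "\<tau> z = z" if "\<tau> \<in> ?P" for \<tau>
    using that by (auto simp: permutes_not_in)
  have s: "?s permutes V" using V by (simp add: permutes_swap_id)
  have B_sub: "?B \<subseteq> {\<sigma>. \<sigma> permutes V}"
    using s by (auto intro!: permutes_compose intro: permutes_subset)
  have zero: "?f \<sigma> = 0" if \<sigma>: "\<sigma> permutes V" "\<sigma> \<notin> ?A" "\<sigma> \<notin> ?B" for \<sigma>
  proof (rule ccontr)
    assume "?f \<sigma> \<noteq> 0"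
    then have nz: "M i (\<sigma> i) \<noteq> 0" if "i \<in> V" for i
      using that V by auto
    have "\<sigma> z \<in> V" using \<sigma>(1) V by (simp add: permutes_in_image)
    then have \<sigma>z: "\<sigma> z = y" using row[of "\<sigma> z"] nz[of z] \<sigma> V by auto
    obtain w where w: "\<sigma> w = z" using \<sigma>(1) by (metis permutes_surj surjD)
    then have "w \<in> V" using \<sigma>(1) V permutes_in_image by metis
    moreover have "w \<noteq> z" using w \<sigma>z V(4) by metis
    ultimately have "w = y" using col[of w] nz[of w] w by metis
    then have \<sigma>y: "\<sigma> y = z" using w by simp
    have "?s \<circ> \<sigma> permutes V" using \<sigma>(1) s by (rule permutes_compose)
    then have "?s \<circ> \<sigma> permutes V - {y, z}"
      by (rule permutes_superset) (use \<sigma>z \<sigma>y in auto)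
    then have "?s \<circ> (?s \<circ> \<sigma>) \<in> ?B" by blast
    then show False using \<sigma>(3) by (simp add: comp_assoc[symmetric])
  qed
  have disj: "?A \<inter> ?B = {}"
  proof -
    have "(?s \<circ> \<tau>) z = y" if "\<tau> \<in> ?P" for \<tau>
      using fix_yz(2)[OF that] by simp
    then show ?thesis using V(4) by force
  qed
  have "permanent V M = sum ?f (?A \<union> ?B)"
    unfolding permanent_def using V B_sub zero finite_permutations
    by (intro sum.mono_neutral_right) auto
  also have "\<dots> = sum ?f ?A + sum ?f ?B"
    using V finite_permutations[of V] finite_permutations[of "V - {y, z}"] disj
    by (intro sum.union_disjoint) auto
  also have "sum ?f ?B = (\<Sum>\<tau>\<in>?P. ?f (?s \<circ> \<tau>))"
    using fun.inj_map[of ?s] by (subst sum.reindex) (auto intro: inj_on_subset)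
  also have "\<dots> = (\<Sum>\<tau>\<in>?P. M z y * M y z * (\<Prod>i\<in>V - {y, z}. M i (\<tau> i)))"
  proof (rule sum.cong[OF refl])
    fix \<tau> assume \<tau>: "\<tau> \<in> ?P"
    have "?f (?s \<circ> \<tau>) = M z y * (M y z * (\<Prod>i\<in>V - {z} - {y}. M i ((?s \<circ> \<tau>) i)))"
      using V fix_yz[OF \<tau>] prod.remove[of V z "\<lambda>i. M i ((?s \<circ> \<tau>) i)"]
        prod.remove[of "V - {z}" y "\<lambda>i. M i ((?s \<circ> \<tau>) i)"] by simp
    also have "(\<Prod>i\<in>V - {z} - {y}. M i ((?s \<circ> \<tau>) i)) = (\<Prod>i\<in>V - {y, z}. M i (\<tau> i))"
    proof (rule prod.cong)
      fix i assume "i \<in> V - {y, z}"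
      then have "\<tau> i \<in> V - {y, z}" using \<tau> permutes_in_image[of \<tau>] by blast
      then show "M i ((?s \<circ> \<tau>) i) = M i (\<tau> i)" by auto
    qed auto
    finally show "?f (?s \<circ> \<tau>) = M z y * M y z * (\<Prod>i\<in>V - {y, z}. M i (\<tau> i))" by simp
  qed
  also have "\<dots> = M z y * M y z * permanent (V - {y, z}) M"
    by (simp add: permanent_def sum_distrib_left)
  finally show ?thesis using permanent_fixed_index[OF V(1,2)] by simp
qed

section \<open>Deleting leaves\<close>

text \<open>Dividing each row by the degree turns the Laplacian ratio into a permanent. The degrees stay
  those of the whole graph when \<open>V\<close> shrinks, so leaves can be removed without changing the
  remaining entries.\<close>

definition local_ratio :: "'a graph \<Rightarrow> 'a set \<Rightarrow> real" where
  "local_ratio G V = permanent V (\<lambda>u v. laplacian G u v / real (degree G u))"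

lemma laplacian_ratio_eq: "laplacian_ratio G = local_ratio G (vertices G)"
  by (simp add: laplacian_ratio_def local_ratio_def permanent_def sum_divide_distrib prod_dividef)

lemma local_ratio_empty [simp]: "local_ratio G {} = 1"
  by (simp add: local_ratio_def permanent_def)

lemma simple_graph_no_loop:
  assumes "simple_graph G"
  shows "{u, u} \<notin> edges G"
proof
  assume "{u, u} \<in> edges G"
  then obtain v w where "v \<noteq> w" "{u, u} = {v, w}"
    using assms unfolding simple_graph_def by meson
  then show False by (simp add: doubleton_eq_iff)
qed

lemma laplacian_diag: "simple_graph G \<Longrightarrow> laplacian G u u = real (degree G u)"
  using simple_graph_no_loop[of G u]
  by (simp add: laplacian_def degree_matrix_def adjacency_matrix_def)

lemma laplacian_off_diag: "u \<noteq> v \<Longrightarrow> laplacian G u v = (if {u, v} \<in> edges G then - 1 else 0)"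
  by (simp add: laplacian_def degree_matrix_def adjacency_matrix_def)

lemma local_ratio_isolated:
  assumes "simple_graph G" "finite V" "z \<in> V" "degree G z > 0"
    and "\<And>v. v \<in> V \<Longrightarrow> {z, v} \<notin> edges G"
  shows "local_ratio G V = local_ratio G (V - {z})"
proof -
  let ?M = "\<lambda>u v. laplacian G u v / real (degree G u)"
  have "?M z v = 0" if "v \<in> V" "v \<noteq> z" for v
    using assms(5)[OF that(1)] that(2) by (simp add: laplacian_off_diag)
  then have "permanent V ?M = ?M z z * permanent (V - {z}) ?M"
    using assms by (intro permanent_isolated) auto
  then show ?thesis using assms by (simp add: local_ratio_def laplacian_diag)
qed

lemma local_ratio_leaf:
  assumes G: "simple_graph G" "finite V" "z \<in> V" "y \<in> V" "degree G z > 0"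
    and edge: "{z, y} \<in> edges G"
    and leaf: "\<And>v. v \<in> V \<Longrightarrow> {z, v} \<in> edges G \<Longrightarrow> v = y"
  shows "local_ratio G V = local_ratio G (V - {z})
    + local_ratio G (V - {y, z}) / (real (degree G y) * real (degree G z))"
proof -
  have "y \<noteq> z" using simple_graph_no_loop[OF G(1)] edge by metis
  let ?M = "\<lambda>u v. laplacian G u v / real (degree G u)"
  have "?M z v = 0" "?M v z = 0" if "v \<in> V" "v \<noteq> z" "v \<noteq> y" for v
  proof -
    have "{z, v} \<notin> edges G" "{v, z} \<notin> edges G"
      using leaf[of v] that by (auto simp: insert_commute)
    then show "?M z v = 0" "?M v z = 0" using that by (simp_all add: laplacian_off_diag)
  qed
  then have "permanent V ?M
      = ?M z z * permanent (V - {z}) ?M + ?M z y * ?M y z * permanent (V - {y, z}) ?M"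
    using G \<open>y \<noteq> z\<close> by (intro permanent_leaf) auto
  moreover have Mzz: "?M z z = 1" using G by (simp add: laplacian_diag)
  moreover have Mzy: "?M z y * ?M y z = 1 / (real (degree G y) * real (degree G z))"
  proof -
    have "{y, z} \<in> edges G" using edge by (simp add: insert_commute)
    then show ?thesis using edge \<open>y \<noteq> z\<close> by (simp add: laplacian_off_diag)
  qed
  ultimately show ?thesis unfolding local_ratio_def Mzz Mzy by simp
qed

section \<open>The trees \<open>T(a)\<close>\<close>

lemma edges_T_X: "{X i, v} \<in> edges (T a) \<longleftrightarrow>
    (\<exists>j. v = Y i j \<and> i < length a \<and> j < a ! i)
    \<or> v = X (Suc i) \<and> Suc i < length a \<or> (\<exists>k. i = Suc k \<and> v = X k \<and> i < length a)"
  by (auto simp: T_def doubleton_eq_iff)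

lemma edges_T_Y: "{Y i j, v} \<in> edges (T a) \<longleftrightarrow>
    i < length a \<and> j < a ! i \<and> (v = X i \<or> v = Z i j)"
  by (auto simp: T_def doubleton_eq_iff)

lemma edges_T_Z: "{Z i j, v} \<in> edges (T a) \<longleftrightarrow> i < length a \<and> j < a ! i \<and> v = Y i j"
  by (auto simp: T_def doubleton_eq_iff)

lemma degree_T_Y:
  assumes "i < length a" "j < a ! i"
  shows "degree (T a) (Y i j) = 2"
proof -
  have "{u \<in> vertices (T a). {Y i j, u} \<in> edges (T a)} = {X i, Z i j}"
    using assms unfolding edges_T_Y by (auto simp: T_def)
  then show ?thesis by (simp add: degree_def)
qed

lemma degree_T_Z:
  assumes "i < length a" "j < a ! i"
  shows "degree (T a) (Z i j) = 1"
proof -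
  have "{u \<in> vertices (T a). {Z i j, u} \<in> edges (T a)} = {Y i j}"
    using assms unfolding edges_T_Z by (auto simp: T_def)
  then show ?thesis by (simp add: degree_def)
qed

lemma degree_T_X:
  assumes "i < length a"
  shows "degree (T a) (X i) = a ! i + (if Suc i < length a then 1 else 0) + (if 0 < i then 1 else 0)"
proof -
  let ?R = "if Suc i < length a then {X (Suc i)} else {}"
  let ?L = "if 0 < i then {X (i - 1)} else {}"
  have "{u \<in> vertices (T a). {X i, u} \<in> edges (T a)} = Y i ` {..<a ! i} \<union> (?R \<union> ?L)"
    using assms unfolding edges_T_X by (cases i) (auto simp: T_def)
  moreover have "card (Y i ` {..<a ! i} \<union> (?R \<union> ?L)) = a ! i + (card ?R + card ?L)"
    by (subst card_Un_disjoint) (auto simp: card_image inj_on_def)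
  ultimately show ?thesis by (simp add: degree_def)
qed

definition pendant_paths :: "nat \<Rightarrow> nat \<Rightarrow> tvertex set" where
  "pendant_paths i n = Y i ` {..<n} \<union> Z i ` {..<n}"

lemma finite_pendant_paths [simp]: "finite (pendant_paths i n)"
  by (simp add: pendant_paths_def)

lemma pendant_paths_0 [simp]: "pendant_paths i 0 = {}"
  by (simp add: pendant_paths_def)

lemma pendant_paths_Suc:
  "pendant_paths i (Suc n) = insert (Y i n) (insert (Z i n) (pendant_paths i n))"
  by (auto simp: pendant_paths_def lessThan_Suc)

lemma local_ratio_detached_path:
  assumes ij: "i < length a" "j < a ! i"
    and U: "finite U" "X i \<notin> U" "Y i j \<notin> U" "Z i j \<notin> U"
  shows "local_ratio (T a) (insert (Y i j) (insert (Z i j) U)) = 3/2 * local_ratio (T a) U"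
proof -
  let ?w = "local_ratio (T a)"
  have "?w (insert (Y i j) (insert (Z i j) U)) = ?w (insert (Y i j) U) + ?w U / 2"
    using local_ratio_leaf[OF simple_graph_T, of "insert (Y i j) (insert (Z i j) U)" "Z i j" "Y i j" a]
      ij U by (simp add: degree_T_Y degree_T_Z edges_T_Z insert_Diff_if)
  also have "?w (insert (Y i j) U) = ?w U"
    using local_ratio_isolated[OF simple_graph_T, of "insert (Y i j) U" "Y i j" a] ij U
    by (auto simp: degree_T_Y edges_T_Y)
  finally show ?thesis by simp
qed

lemma local_ratio_detached_paths:
  assumes "i < length a" "finite U" "X i \<notin> U" "U \<inter> pendant_paths i n = {}" "n \<le> a ! i"
  shows "local_ratio (T a) (U \<union> pendant_paths i n) = (3/2) ^ n * local_ratio (T a) U"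
  using assms(4,5)
proof (induction n)
  case (Suc n)
  have "X i \<notin> pendant_paths i n" "Y i n \<notin> pendant_paths i n" "Z i n \<notin> pendant_paths i n"
    by (auto simp: pendant_paths_def)
  with Suc assms(1-3) show ?case
    using local_ratio_detached_path[of i a n "U \<union> pendant_paths i n"]
    by (simp add: pendant_paths_Suc)
qed simp

lemma local_ratio_attached_path:
  assumes ij: "i < length a" "j < a ! i"
    and U: "finite U" "X i \<in> U" "Y i j \<notin> U" "Z i j \<notin> U"
  shows "local_ratio (T a) (insert (Y i j) (insert (Z i j) U))
    = 3/2 * local_ratio (T a) U + local_ratio (T a) (U - {X i}) / (2 * real (degree (T a) (X i)))"
proof -
  let ?w = "local_ratio (T a)"
  have "?w (insert (Y i j) (insert (Z i j) U)) = ?w (insert (Y i j) U) + ?w U / 2"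
    using local_ratio_leaf[OF simple_graph_T, of "insert (Y i j) (insert (Z i j) U)" "Z i j" "Y i j" a]
      ij U by (simp add: degree_T_Y degree_T_Z edges_T_Z insert_Diff_if)
  also have "?w (insert (Y i j) U) = ?w U + ?w (U - {X i}) / (2 * real (degree (T a) (X i)))"
  proof -
    have "insert (Y i j) U - {X i, Y i j} = U - {X i}" using U by auto
    then show ?thesis
      using local_ratio_leaf[OF simple_graph_T, of "insert (Y i j) U" "Y i j" "X i" a] ij U
      by (auto simp: degree_T_Y edges_T_Y mult.commute)
  qed
  finally show ?thesis by simp
qed

text \<open>Each path that is not matched to \<open>X i\<close> contributes \<open>3/2\<close>. The second term counts the
  choices of the single path whose inner vertex is matched to \<open>X i\<close>: such a path contributes
  \<open>1 / (2 d)\<close> instead of \<open>3/2\<close>, which is the ratio \<open>1 / (3 d)\<close>, and it uses up \<open>X i\<close>.\<close>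

lemma local_ratio_attached_paths:
  assumes i: "i < length a" "finite U" "X i \<in> U" "U \<inter> pendant_paths i n = {}" "n \<le> a ! i"
  shows "local_ratio (T a) (U \<union> pendant_paths i n) = (3/2) ^ n *
    (local_ratio (T a) U + real n / (3 * real (degree (T a) (X i))) * local_ratio (T a) (U - {X i}))"
  using assms(4,5)
proof (induction n)
  case (Suc n)
  let ?w = "local_ratio (T a)" and ?d = "real (degree (T a) (X i))"
  have new: "X i \<notin> pendant_paths i n" "Y i n \<notin> pendant_paths i n" "Z i n \<notin> pendant_paths i n"
    by (auto simp: pendant_paths_def)
  have disj: "U \<inter> pendant_paths i n = {}" "Y i n \<notin> U" "Z i n \<notin> U" "n < a ! i"
    using Suc.prems by (auto simp: pendant_paths_Suc)
  have U': "U \<union> pendant_paths i n - {X i} = (U - {X i}) \<union> pendant_paths i n"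
    using new(1) by auto
  have "?w (U \<union> pendant_paths i (Suc n)) = 3/2 * ?w (U \<union> pendant_paths i n)
      + ?w (U \<union> pendant_paths i n - {X i}) / (2 * ?d)"
    using local_ratio_attached_path[of i a n "U \<union> pendant_paths i n"] i new disj
    by (simp add: pendant_paths_Suc)
  also have "?w (U \<union> pendant_paths i n - {X i}) = (3/2) ^ n * ?w (U - {X i})"
    unfolding U' using i disj by (intro local_ratio_detached_paths) auto
  also have "?w (U \<union> pendant_paths i n)
      = (3/2) ^ n * (?w U + real n / (3 * ?d) * ?w (U - {X i}))"
    using Suc.IH disj by simp
  finally show ?case by (cases "?d = 0") (simp_all add: field_simps)
qed simp

section \<open>Recursion along the spine\<close>

text \<open>Removing spine vertices from the left, with their pendant paths, leaves the parts of the
  tree over the spine indices from \<open>k\<close> on; in each of them \<open>X k\<close> becomes a leaf once its own paths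
  are gone.\<close>

definition tail_part :: "nat list \<Rightarrow> nat \<Rightarrow> tvertex set" where
  "tail_part a k = {X i | i. k \<le> i \<and> i < length a}
    \<union> (\<Union>i\<in>{k..<length a}. pendant_paths i (a ! i))"

lemma finite_tail_part [simp]: "finite (tail_part a k)"
proof -
  have "{X i | i. k \<le> i \<and> i < length a} = X ` {k..<length a}" by auto
  then show ?thesis by (simp add: tail_part_def)
qed

lemma tail_part_0: "tail_part a 0 = vertices (T a)"
  by (auto simp: tail_part_def pendant_paths_def T_def)

lemma tail_part_length [simp]: "tail_part a (length a) = {}"
  by (auto simp: tail_part_def)

lemma tail_part_step:
  assumes "k < length a"
  shows "tail_part a k = insert (X k) (tail_part a (Suc k)) \<union> pendant_paths k (a ! k)"
proof -
  have "{k..<length a} = insert k {Suc k..<length a}" using assms by auto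
  then show ?thesis using assms by (auto simp: tail_part_def le_eq_less_or_eq Suc_le_eq)
qed

lemma tail_part_fresh: "X k \<notin> tail_part a (Suc k)" "tail_part a (Suc k) \<inter> pendant_paths k n = {}"
  by (auto simp: tail_part_def pendant_paths_def)

lemma X_in_tail_part: "X i \<in> tail_part a k \<longleftrightarrow> k \<le> i \<and> i < length a"
  by (auto simp: tail_part_def pendant_paths_def)

lemma Y_in_tail_part: "Y i j \<in> tail_part a k \<longleftrightarrow> k \<le> i \<and> i < length a \<and> j < a ! i"
  by (auto simp: tail_part_def pendant_paths_def)

lemma local_ratio_tail_minus_root:
  assumes "k < length a"
  shows "local_ratio (T a) (tail_part a k - {X k})
    = (3/2) ^ (a ! k) * local_ratio (T a) (tail_part a (Suc k))"
proof -
  have "tail_part a k - {X k} = tail_part a (Suc k) \<union> pendant_paths k (a ! k)"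
    using tail_part_step[OF assms] tail_part_fresh(1)[of k a] by (auto simp: pendant_paths_def)
  then show ?thesis
    using local_ratio_detached_paths[of k a "tail_part a (Suc k)" "a ! k"] assms tail_part_fresh
    by simp
qed

lemma local_ratio_tail_last:
  assumes "2 \<le> length a" "Suc k = length a"
  shows "local_ratio (T a) (tail_part a k)
    = (3/2) ^ (a ! k) * (1 + real (a ! k) / (3 * real (degree (T a) (X k))))"
proof -
  have k: "k < length a" using assms by simp
  have "tail_part a (Suc k) = {}" using assms by simp
  moreover have "local_ratio (T a) {X k} = 1"
    using local_ratio_isolated[OF simple_graph_T, of "{X k}" "X k" a] assms k
      simple_graph_no_loop[OF simple_graph_T, of "X k" a]
    by (simp add: degree_T_X)
  ultimately show ?thesis
    using local_ratio_attached_paths[of k a "{X k}" "a ! k"] k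
    by (auto simp: tail_part_step[OF k] pendant_paths_def)
qed

lemma local_ratio_tail_step:
  assumes "Suc k < length a"
  shows "local_ratio (T a) (tail_part a k) = (3/2) ^ (a ! k) *
    ((1 + real (a ! k) / (3 * real (degree (T a) (X k)))) * local_ratio (T a) (tail_part a (Suc k))
     + local_ratio (T a) (tail_part a (Suc k) - {X (Suc k)})
       / (real (degree (T a) (X k)) * real (degree (T a) (X (Suc k)))))"
proof -
  let ?w = "local_ratio (T a)" and ?W = "tail_part a (Suc k)"
  let ?d = "\<lambda>i. real (degree (T a) (X i))"
  have k: "k < length a" using assms by simp
  have "?w (tail_part a k) = (3/2) ^ (a ! k) *
      (?w (insert (X k) ?W) + real (a ! k) / (3 * ?d k) * ?w (insert (X k) ?W - {X k}))"
    unfolding tail_part_step[OF k] using k tail_part_fresh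
    by (intro local_ratio_attached_paths) (auto simp: pendant_paths_def)
  also have "insert (X k) ?W - {X k} = ?W" using tail_part_fresh(1) by simp
  also have "?w (insert (X k) ?W)
      = ?w (insert (X k) ?W - {X k}) + ?w (insert (X k) ?W - {X (Suc k), X k}) / (?d (Suc k) * ?d k)"
    using assms
    by (intro local_ratio_leaf simple_graph_T)
      (auto simp: edges_T_X degree_T_X X_in_tail_part Y_in_tail_part)
  also have "insert (X k) ?W - {X k} = ?W" using tail_part_fresh(1) by simp
  also have "insert (X k) ?W - {X (Suc k), X k} = ?W - {X (Suc k)}"
    using tail_part_fresh(1) by auto
  finally show ?thesis by (simp add: algebra_simps)
qed

text \<open>The five terms correspond to the matchings of the spine \<open>X 0 - X 1 - X 2 - X 3\<close>: the empty one,
  the three single edges, and the pair of outer edges. End vertices have one spine neighbour and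
  inner vertices two, whence the degrees.\<close>

lemma laplacian_ratio_spine_4:
  fixes a0 a1 a2 a3 :: nat
  defines "d0 \<equiv> real a0 + 1" and "d1 \<equiv> real a1 + 2"
    and "d2 \<equiv> real a2 + 2" and "d3 \<equiv> real a3 + 1"
  defines "p0 \<equiv> 1 + real a0 / (3 * d0)" and "p1 \<equiv> 1 + real a1 / (3 * d1)"
    and "p2 \<equiv> 1 + real a2 / (3 * d2)" and "p3 \<equiv> 1 + real a3 / (3 * d3)"
  shows "laplacian_ratio (T [a0, a1, a2, a3]) = (3/2) ^ (a0 + a1 + a2 + a3) *
    (p0 * p1 * p2 * p3 + p2 * p3 / (d0 * d1) + p0 * p3 / (d1 * d2) + p0 * p1 / (d2 * d3)
      + 1 / (d0 * d1 * d2 * d3))"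
proof -
  let ?a = "[a0, a1, a2, a3]"
  let ?w = "\<lambda>k. local_ratio (T ?a) (tail_part ?a k)"
  have deg: "real (degree (T ?a) (X 0)) = d0" "real (degree (T ?a) (X (Suc 0))) = d1"
    "real (degree (T ?a) (X 2)) = d2" "real (degree (T ?a) (X 3)) = d3"
    by (simp_all add: degree_T_X d0_def d1_def d2_def d3_def)
  have w4: "?w 4 = 1" using tail_part_length[of ?a] by (simp add: numeral_eq_Suc)
  have w3: "?w 3 = (3/2) ^ a3 * p3"
    using local_ratio_tail_last[of ?a 3] deg by (simp add: p3_def)
  have w2: "?w 2 = (3/2) ^ a2 * (p2 * ?w 3 + (3/2) ^ a3 / (d2 * d3))"
    using local_ratio_tail_step[of 2 ?a] local_ratio_tail_minus_root[of 3 ?a] deg w4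
    by (simp add: p2_def)
  have w1: "?w 1 = (3/2) ^ a1 * (p1 * ?w 2 + (3/2) ^ a2 * ?w 3 / (d1 * d2))"
    using local_ratio_tail_step[of 1 ?a] local_ratio_tail_minus_root[of 2 ?a] deg
    by (simp add: p1_def numeral_2_eq_2 numeral_3_eq_3)
  have w0: "?w 0 = (3/2) ^ a0 * (p0 * ?w 1 + (3/2) ^ a1 * ?w 2 / (d0 * d1))"
    using local_ratio_tail_step[of 0 ?a] local_ratio_tail_minus_root[of 1 ?a] deg
    by (simp add: p0_def numeral_2_eq_2)
  have "laplacian_ratio (T ?a) = ?w 0" by (simp add: laplacian_ratio_eq tail_part_0)
  then show ?thesis
    unfolding w0 w1 w2 w3 by (simp add: power_add algebra_simps add_divide_distrib)
qed

section \<open>The inequality\<close>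

lemma card_vertices_T: "card (vertices (T a)) = length a + 2 * (\<Sum>i<length a. a ! i)"
proof -
  let ?S = "SIGMA i:{..<length a}. {..<a ! i}"
  have eq: "vertices (T a) = X ` {..<length a} \<union> (case_prod Y ` ?S \<union> case_prod Z ` ?S)"
    by (force simp: T_def)
  have "card (vertices (T a)) = card (X ` {..<length a}) + (card (case_prod Y ` ?S) + card (case_prod Z ` ?S))"
    unfolding eq by (subst card_Un_disjoint, auto)+
  also have "card (X ` {..<length a}) = length a" by (subst card_image) (auto simp: inj_on_def)
  also have "card (case_prod Y ` ?S) = card ?S" by (rule card_image) (auto simp: inj_on_def)
  also have "card (case_prod Z ` ?S) = card ?S" by (rule card_image) (auto simp: inj_on_def)
  finally show ?thesis by simp
qed

text \<open>The left side is \<open>12\<close> times the five-term matching sum with its denominator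
  \<open>81 (t + 1)\<^sup>2 (t + 2) (t + 3)\<close> cleared, and the right side is the claimed bound over the same
  denominator. Expanding around \<open>t = 4\<close> makes all coefficients of the difference positive.\<close>

lemma matching_sum_bound:
  fixes t :: real
  assumes "t \<ge> 4"
  shows "12 * ((4*t+3)^2 * (4*t+6) * (4*t+10) + 9 * (4*t+10) * (4*t+3) + 9 * (4*t+3)^2
      + 9 * (4*t+3) * (4*t+6) + 81) > 81 * (32*t^2 + 56*t + 29) * (t+2) * (t+3)"
proof -
  define s where "s = t - 4"
  have s: "s \<ge> 0" "t = s + 4" using assms by (simp_all add: s_def)
  have "12 * ((4*t+3)^2 * (4*t+6) * (4*t+10) + 9 * (4*t+10) * (4*t+3) + 9 * (4*t+3)^2
      + 9 * (4*t+3) * (4*t+6) + 81) - 81 * (32*t^2 + 56*t + 29) * (t+2) * (t+3)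
    = 480 * s^4 + 7080 * s^3 + 35163 * s^2 + 61671 * s + 13830"
    unfolding s(2) by algebra
  moreover have "480 * s^4 + 7080 * s^3 + 35163 * s^2 + 61671 * s + 13830 > 0"
    using s(1) by (intro add_nonneg_pos add_nonneg_nonneg) auto
  ultimately show ?thesis by linarith
qed

theorem mainTheorem4:
  fixes t n :: nat
  assumes "t \<ge> 4"
    and "n = card (vertices (T [t, t, t + 1, t]))"
  shows "n = 8 * t + 6 \<and> n mod 4 = 2 \<and>
    laplacian_ratio (T [t, t, t + 1, t]) >
      (4 * (real n)\<^sup>2 + 8 * real n + 40) / (real n + 2)\<^sup>2 * (3 / 2) powr ((real n - 6) / 2)"
proof (intro conjI)
  show n: "n = 8 * t + 6"
    using assms(2) by (simp add: card_vertices_T lessThan_Suc numeral_eq_Suc)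
  then show "n mod 4 = 2" by presburger
  define x where "x = real t"
  have x: "x \<ge> 4" using assms(1) by (simp add: x_def)
  let ?N = "(4*x+3)^2 * (4*x+6) * (4*x+10) + 9 * (4*x+10) * (4*x+3) + 9 * (4*x+3)^2
      + 9 * (4*x+3) * (4*x+6) + 81"
  let ?D = "(x+1)^2 * (x+2) * (x+3)"
  have p: "1 + x / (3 * (x+1)) = (4*x+3) / (3 * (x+1))"
    "1 + x / (3 * (x+2)) = (4*x+6) / (3 * (x+2))"
    "1 + (x+1) / (3 * (x+3)) = (4*x+10) / (3 * (x+3))"
    using x by (simp_all add: field_simps)
  \<comment> \<open>The matching sum over its common denominator, for equal outer factors \<open>A / (3a)\<close>. Stated for
    abstract numerators and denominators so that clearing denominators does not expand them.\<close>
  have sum: "A / (3*a) * (B / (3*b)) * (C / (3*c)) * (A / (3*a)) + C / (3*c) * (A / (3*a)) / (a*b)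
      + A / (3*a) * (A / (3*a)) / (b*c) + A / (3*a) * (B / (3*b)) / (c*a) + 1 / (a*b*c*a)
    = (A^2 * B * C + 9 * C * A + 9 * A^2 + 9 * A * B + 81) / (81 * (a^2 * b * c))"
    if "a > 0" "b > 0" "c > 0" for A B C a b c :: real
    using that by (simp add: divide_simps) algebra
  have "laplacian_ratio (T [t, t, t + 1, t]) = (3/2) ^ (4 * t + 1) * (?N / (81 * ?D))"
  proof -
    have c: "real t = x" "real (t + 1) = x + 1" "x + 1 + 2 = x + 3" "t + t + (t + 1) + t = 4 * t + 1"
      by (simp_all add: x_def)
    show ?thesis
      unfolding laplacian_ratio_spine_4 c p using x by (subst sum) simp_all
  qed
  also have "(3/2) ^ (4 * t + 1) = (3/2::real) powr ((real n - 6) / 2) * (3/2)"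
    using powr_realpow[of "3/2" "4 * t"] by (simp add: n)
  finally have ratio: "laplacian_ratio (T [t, t, t + 1, t])
    = (3/2) powr ((real n - 6) / 2) * (3/2 * (?N / (81 * ?D)))"
    by (simp only: mult.assoc)
  have "(4 * (real n)\<^sup>2 + 8 * real n + 40) / (real n + 2)\<^sup>2
      = (32 * x^2 + 56 * x + 29) / (8 * (x+1)^2)"
  proof -
    have "real n = 8 * x + 6" by (simp add: n x_def)
    then have eq: "4 * (real n)\<^sup>2 + 8 * real n + 40 = 8 * (32 * x^2 + 56 * x + 29)"
      "(real n + 2)\<^sup>2 = 8 * (8 * (x+1)^2)"
      by (simp_all add: power2_eq_square algebra_simps)
    show ?thesis unfolding eq by (rule mult_divide_mult_cancel_left) simp
  qed
  also have "\<dots> < 3/2 * (?N / (81 * ?D))"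
  proof -
    have D: "?D > 0" using x by simp
    have "(32 * x^2 + 56 * x + 29) / (8 * (x+1)^2)
        = 81 * (32 * x^2 + 56 * x + 29) * (x+2) * (x+3) / (8 * (81 * ?D))"
      using x by (simp add: divide_simps)
    also have "\<dots> < 12 * ?N / (8 * (81 * ?D))"
      using matching_sum_bound[OF x] D by (intro divide_strict_right_mono) auto
    also have "\<dots> = 3/2 * (?N / (81 * ?D))"
    proof -
      have "12 * N / (8 * E) = 3/2 * (N / E)" for N E :: real by simp
      then show ?thesis .
    qed
    finally show ?thesis .
  qed
  finally show "(4 * (real n)\<^sup>2 + 8 * real n + 40) / (real n + 2)\<^sup>2
      * (3 / 2) powr ((real n - 6) / 2) < laplacian_ratio (T [t, t, t + 1, t])"
    unfolding ratio by (simp only: mult.commute[of _ "(3/2) powr _"] mult_strict_left_mono powr_gt_zero)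
qed

end
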